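(* Let $\gamma:\Gamma\to\Delta$ be a graph map of finite graphs, let $w:I\to\Delta$ be a primitive loop and let $\hat w:S^1\to\Delta$ be the associated primitive cycle. There are at most $2\cdot|\bar E(\Gamma)|$ components of $\Omega^4_{\gamma,w}$ that do not factor through $\Gamma-\bar V(\Gamma)$ (that is, whose image in $\Gamma$ under the projection contains a vertex of $\bar V(\Gamma)$).
   Context: A graph is a directed graph $\Gamma=(V,E,o,t)$ with origin and target maps $o,t:E\to V$ (loops and multiple edges allowed). A graph map commutes with $o,t$. A path is a graph map from a directed segment $I$; it is identified with the word of edges it traverses; $*$ is concatenation. A path $w$ is a loop if its first and last vertices agree, and primitive if it is not $u^k$ for a path $u$ and $k\ge2$. For a loop $w:I\to\Delta$, $\hat w:S^1\to\Delta$ is the cycle obtained by identifying the endpoints of $I$. $\bar V(\Gamma)$ is the set of vertices whose indegree is $\ne1$ or whose outdegree is $\ne1$; $\Gamma-\bar V(\Gamma)$ is the maximal subgraph containing no vertex of $\bar V(\Gamma)$. $\bar E(\Gamma)$ is the collection (up to reparametrisation) of paths, injective on edges, whose image meets $\bar V(\Gamma)$ exactly in their first and last vertices, together with cycles, injective on edges, whose image is disjoint from $\bar V(\Gamma)$ (maximal unbranched segments and circle components of $\Gamma$). The fibre product $\Gamma\times_\Delta S^1$ of $\gamma$ and $\hat w$ has vertices the pairs $(u,v)\in V(\Gamma)\times V(S^1)$ with equal image in $\Delta$, edges the pairs of edges with equal image, coordinatewise $o,t$. $\Omega_{\gamma,w}\subset\Gamma\times_\Delta S^1$ is the union of the connected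 components that surject onto $S^1$. A path $f:I\to\Gamma$ is a $w$-path if $\gamma\circ f$ factors surjectively through $\hat w$; then uniquely $\gamma\circ f=w'*w^n*w''$ with $w'$ a proper suffix and $w''$ a proper prefix of $w$ (possibly empty), and $|f|_w=n$ is its $w$-length. $\Omega^k_{\gamma,w}\subset\Omega_{\gamma,w}$ is the union of the components which support a $w$-path of $w$-length at least $k$, i.e. contain a path whose projection to $\Gamma$ is a $w$-path of $w$-length at least $k$. *)

theory Defs
  imports "Graph_Theory.Digraph_Component" "HOL-Library.Sublist"
begin

text \<open>
  A path is given by the word of edges it traverses, that is, by an
  \<^const>\<open>pre_digraph.awalk\<close> (which also mentions its first and its last vertex).
  A graph map is given by its vertex map and its edge map, which matter only on the
  vertices and edges of the source.
\<close>

definition graph_map ::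
  "('a,'b) pre_digraph \<Rightarrow> ('c,'d) pre_digraph \<Rightarrow> ('a \<Rightarrow> 'c) \<Rightarrow> ('b \<Rightarrow> 'd) \<Rightarrow> bool" where
  "graph_map G H fV fE \<longleftrightarrow>
     (\<forall>v\<in>verts G. fV v \<in> verts H) \<and>
     (\<forall>e\<in>arcs G. fE e \<in> arcs H \<and>
        tail H (fE e) = fV (tail G e) \<and> head H (fE e) = fV (head G e))"

definition loop :: "('a,'b) pre_digraph \<Rightarrow> 'b list \<Rightarrow> bool" where
  "loop G w \<longleftrightarrow> (\<exists>x. pre_digraph.awalk G x w x)"

definition word_power :: "'b list \<Rightarrow> nat \<Rightarrow> 'b list" where
  "word_power u k = concat (replicate k u)"

text \<open>The empty path is a power of itself, so a primitive loop has positive length.\<close>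

definition primitive :: "('a,'b) pre_digraph \<Rightarrow> 'b list \<Rightarrow> bool" where
  "primitive G w \<longleftrightarrow>
     \<not> (\<exists>u k. (\<exists>x y. pre_digraph.awalk G x u y) \<and> 2 \<le> k \<and> w = word_power u k)"

subsection \<open>Maximal unbranched segments\<close>

definition bar_V :: "('a,'b) pre_digraph \<Rightarrow> 'a set" where
  "bar_V G = {v \<in> verts G. in_degree G v \<noteq> 1 \<or> out_degree G v \<noteq> 1}"

text \<open>The largest subgraph avoiding a set of vertices is induced by the complement.\<close>

definition minus_bar_V :: "('a,'b) pre_digraph \<Rightarrow> ('a,'b) pre_digraph" where
  "minus_bar_V G = G \<restriction> (verts G - bar_V G)"

text \<open>
  Segments have at least one edge. The positions at which a segment visits
  \<^const>\<open>bar_V\<close> are exactly the first and the last one. Comparing only the sets of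
  visited vertices would be wrong: on a figure eight it would admit the
  concatenation of the two loops.
\<close>

definition segments :: "('a,'b) pre_digraph \<Rightarrow> 'b list set" where
  "segments G = {p. p \<noteq> [] \<and> distinct p \<and> (\<exists>u v. pre_digraph.awalk G u p v \<and>
     (\<forall>i \<le> length p. pre_digraph.awalk_verts G u p ! i \<in> bar_V G \<longleftrightarrow> i = 0 \<or> i = length p))}"

definition circles :: "('a,'b) pre_digraph \<Rightarrow> 'b list set" where
  "circles G = {c. c \<noteq> [] \<and> distinct c \<and> (\<exists>u. pre_digraph.awalk G u c u \<and>
     set (pre_digraph.awalk_verts G u c) \<inter> bar_V G = {})}"

text \<open>
  A word of edges determines a path up to reparametrisation, whereas it determines a
  cycle only after the choice of a starting point; a cycle up to reparametrisation is
  the set of all rotations of such a word. No word is both a segment and a circle.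
\<close>

definition bar_E :: "('a,'b) pre_digraph \<Rightarrow> 'b list set set" where
  "bar_E G = {{p} | p. p \<in> segments G} \<union> {{rotate n c | n. True} | c. c \<in> circles G}"

subsection \<open>Cycles and fibre products\<close>

definition circle_graph :: "nat \<Rightarrow> (nat, nat) pre_digraph" where
  "circle_graph n =
     \<lparr>verts = {..<n}, arcs = {..<n}, tail = (\<lambda>i. i), head = (\<lambda>i. Suc i mod n)\<rparr>"

text \<open>
  For a nonempty loop \<open>w\<close>, the cycle obtained from it is the graph map from
  \<^term>\<open>circle_graph (length w)\<close> with the following vertex and edge maps.
\<close>

definition cycle_vert :: "('a,'b) pre_digraph \<Rightarrow> 'b list \<Rightarrow> nat \<Rightarrow> 'a" where
  "cycle_vert G w i = tail G (w ! i)"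

definition cycle_arc :: "'b list \<Rightarrow> nat \<Rightarrow> 'b" where
  "cycle_arc w i = w ! i"

definition fibre_product ::
  "('a,'b) pre_digraph \<Rightarrow> ('a \<Rightarrow> 'x) \<Rightarrow> ('b \<Rightarrow> 'y) \<Rightarrow>
   ('c,'d) pre_digraph \<Rightarrow> ('c \<Rightarrow> 'x) \<Rightarrow> ('d \<Rightarrow> 'y) \<Rightarrow> ('a \<times> 'c, 'b \<times> 'd) pre_digraph" where
  "fibre_product G fV fE H gV gE =
     \<lparr>verts = {(u, v). u \<in> verts G \<and> v \<in> verts H \<and> fV u = gV v},
      arcs = {(e, d). e \<in> arcs G \<and> d \<in> arcs H \<and> fE e = gE d},
      tail = (\<lambda>(e, d). (tail G e, tail H d)),
      head = (\<lambda>(e, d). (head G e, head H d))\<rparr>"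

definition cycle_fibre_product ::
  "('a,'b) pre_digraph \<Rightarrow> ('x,'y) pre_digraph \<Rightarrow> ('a \<Rightarrow> 'x) \<Rightarrow> ('b \<Rightarrow> 'y) \<Rightarrow> 'y list \<Rightarrow>
   ('a \<times> nat, 'b \<times> nat) pre_digraph" where
  "cycle_fibre_product G D gV gE w =
     fibre_product G gV gE (circle_graph (length w)) (cycle_vert D w) (cycle_arc w)"

text \<open>Connectedness ignores the direction of edges and excludes the empty graph.\<close>

definition components :: "('a,'b) pre_digraph \<Rightarrow> ('a,'b) pre_digraph set" where
  "components G = {C. pre_digraph.max_subgraph G connected C}"

definition Omega ::
  "('a,'b) pre_digraph \<Rightarrow> ('x,'y) pre_digraph \<Rightarrow> ('a \<Rightarrow> 'x) \<Rightarrow> ('b \<Rightarrow> 'y) \<Rightarrow> 'y list \<Rightarrow>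
   ('a \<times> nat, 'b \<times> nat) pre_digraph" where
  "Omega G D gV gE w =
     pre_digraph.Union (cycle_fibre_product G D gV gE w)
       {C \<in> components (cycle_fibre_product G D gV gE w).
          snd ` verts C = verts (circle_graph (length w)) \<and>
          snd ` arcs C = arcs (circle_graph (length w))}"

subsection \<open>Paths reading a power of the loop\<close>

text \<open>The path \<open>g\<close> below is the factorisation through the cycle.\<close>

definition w_path ::
  "('a,'b) pre_digraph \<Rightarrow> ('b \<Rightarrow> 'y) \<Rightarrow> 'y list \<Rightarrow> 'b list \<Rightarrow> bool" where
  "w_path G gE w f \<longleftrightarrow>
     (\<exists>u v. pre_digraph.awalk G u f v) \<and>
     (\<exists>i g j. pre_digraph.awalk (circle_graph (length w)) i g j \<and>
        map gE f = map (cycle_arc w) g \<and>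
        set (pre_digraph.awalk_verts (circle_graph (length w)) i g)
          = verts (circle_graph (length w)) \<and>
        set g = arcs (circle_graph (length w)))"

text \<open>Meaningful only for a \<open>w\<close>-path with \<open>w\<close> primitive, where the number is unique.\<close>

definition w_length :: "('b \<Rightarrow> 'y) \<Rightarrow> 'y list \<Rightarrow> 'b list \<Rightarrow> nat" where
  "w_length gE w f =
     (THE n. \<exists>w' w''. strict_suffix w' w \<and> strict_prefix w'' w \<and>
        map gE f = w' @ word_power w n @ w'')"

definition supports_w_path ::
  "('a,'b) pre_digraph \<Rightarrow> ('b \<Rightarrow> 'y) \<Rightarrow> 'y list \<Rightarrow> nat \<Rightarrow>
   ('a \<times> nat, 'b \<times> nat) pre_digraph \<Rightarrow> bool" where
  "supports_w_path G gE w k C \<longleftrightarrow>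
     (\<exists>a p b. pre_digraph.awalk C a p b \<and>
        w_path G gE w (map fst p) \<and> k \<le> w_length gE w (map fst p))"

definition Omega_ge ::
  "nat \<Rightarrow> ('a,'b) pre_digraph \<Rightarrow> ('x,'y) pre_digraph \<Rightarrow> ('a \<Rightarrow> 'x) \<Rightarrow> ('b \<Rightarrow> 'y) \<Rightarrow> 'y list \<Rightarrow>
   ('a \<times> nat, 'b \<times> nat) pre_digraph" where
  "Omega_ge k G D gV gE w =
     pre_digraph.Union (Omega G D gV gE w)
       {C \<in> components (Omega G D gV gE w). supports_w_path G gE w k C}"

text \<open>The projection of a subgraph of the fibre product has image in \<open>G'\<close>.\<close>

definition factors_through ::
  "('a \<times> nat, 'b \<times> nat) pre_digraph \<Rightarrow> ('a,'b) pre_digraph \<Rightarrow> bool" where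
  "factors_through C G' \<longleftrightarrow> fst ` verts C \<subseteq> verts G' \<and> fst ` arcs C \<subseteq> arcs G'"

end

(*
  Let m be the length of w. Since w is primitive, its m cyclic shifts are pairwise distinct, so
  two paths reading w periodically along the same m edges are in phase, and then lie in the same
  component of the fibre product. Let c be the phase of the lexicographically largest shift of
  the periodic word w w w ...

  The long path of a component C either runs for m edges into or out of a vertex of bar_V inside
  one segment, or its visits to bar_V are so frequent that it traverses completely a segment on
  which the phase c occurs. (If it never visits bar_V, connectedness of C lets it be prolonged
  until it does.) So C claims an end of a segment: the start, if it reads the first m
  edges or the whole segment through phase c, or otherwise the end, if it reads the last m edges.

  An end is claimed at most once. The only case not settled by m common edges is that C and C'
  both traverse a segment, with phase c at positions t <= t'. Let a be the phase of C' at t and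
  b the phase of C at t'. Shifts a and c agree on t' - t letters, after which they continue as
  c and b; as shift a is at most shift c, shift c is at most shift b, so b = c by maximality.
*)

theory Submission
  imports Defs
begin

subsection \<open>Phases of a primitive word\<close>

text \<open>Primitivity freed from the graph: the cyclic shifts of \<open>w\<close> are pairwise
  distinct. Agreement is stated letter by letter, the form in which it arises when one edge is read
  at two phases.\<close>

definition aperiodic :: "'a list \<Rightarrow> bool" where
  "aperiodic w \<longleftrightarrow> w \<noteq> [] \<and>
     (\<forall>i j. (\<forall>k<length w. w ! ((i + k) mod length w) = w ! ((j + k) mod length w)) \<longrightarrow>
        i mod length w = j mod length w)"

lemma aperiodicD:
  assumes "aperiodic w" "\<And>k. k < length w \<Longrightarrow> w ! ((i + k) mod length w) = w ! ((j + k) mod length w)"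
  shows "i mod length w = j mod length w"
  using assms unfolding aperiodic_def by blast

lemma primitive_loop_nonempty:
  assumes "loop D w" "primitive D w"
  shows "w \<noteq> []"
proof
  assume "w = []"
  moreover obtain x where "pre_digraph.awalk D x w x" using assms(1) by (auto simp: loop_def)
  ultimately have "\<exists>x y. pre_digraph.awalk D x [] y" "w = word_power [] 2"
    by (auto simp: word_power_def)
  then show False using assms(2) unfolding primitive_def by blast
qed

text \<open>If two shifts agree, rotation by their difference fixes \<open>w\<close>. The two pieces
  into which that rotation cuts \<open>w\<close> then commute, so they are powers of one word
  \<open>z\<close>, and \<open>w\<close> is a proper power of \<open>z\<close>.\<close>

lemma rotations_of_primitive_distinct:
  assumes "loop D w" "primitive D w"
    and eq: "\<And>k. k < length w \<Longrightarrow> w ! ((i + k) mod length w) = w ! ((j + k) mod length w)"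
  shows "i mod length w = j mod length w"
proof -
  have False if rot: "rotate d w = w" and d: "d mod length w \<noteq> 0" for d
  proof -
    define e where "e = d mod length w"
    have e: "0 < e" "e < length w"
      using d primitive_loop_nonempty[OF assms(1,2)] by (simp_all add: e_def)
    have "drop e w @ take e w = take e w @ drop e w"
      using rot by (simp add: rotate_drop_take e_def)
    then obtain a b z where z: "concat (replicate a z) = drop e w" "concat (replicate b z) = take e w"
      using comm_append_are_replicate by metis
    have "a \<noteq> 0" "b \<noteq> 0" using z e by (auto intro!: Nat.gr0I)
    then have "2 \<le> b + a" "w = word_power z (b + a)"
      using z by (simp_all add: word_power_def replicate_add)
    moreover obtain x where x: "pre_digraph.awalk D x w x" using assms(1) by (auto simp: loop_def)
    \<comment> \<open>\<open>primitive\<close> speaks only of powers of paths, so \<open>z\<close>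
      must be a walk; it is one as a prefix of \<open>w\<close>.\<close>
    have "w = z @ word_power z (b + a - 1)"
      using \<open>w = word_power z (b + a)\<close> \<open>a \<noteq> 0\<close> by (cases a) (simp_all add: word_power_def)
    then have "\<exists>y. pre_digraph.awalk D x z y"
      using x by (metis pre_digraph.awalk_def pre_digraph.cas_append_iff le_sup_iff set_append)
    ultimately show False using assms(2) unfolding primitive_def by blast
  qed
  then have *: "rotate d w = w \<Longrightarrow> d mod length w = 0" for d by blast
  have rot: "rotate i w = rotate j w"
    by (rule nth_equalityI) (simp_all add: nth_rotate eq)
  \<comment> \<open>Cancelling the smaller of two rotations reduces agreement of two shifts to a
    rotation that fixes \<open>w\<close>.\<close>
  have aux: "k mod length w = l mod length w" if "k \<le> l" "rotate k w = rotate l w" for k l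
  proof -
    have "rotate k (rotate (l - k) w) = rotate k w" using that by (simp add: rotate_rotate)
    moreover have "inj (rotate k :: 'b list \<Rightarrow> _)" by (simp add: rotate_def inj_rotate1)
    ultimately have "rotate (l - k) w = w" by (simp add: inj_eq)
    then have "(l - k) mod length w = 0" by (rule *)
    then show ?thesis using that by (metis le_add_diff_inverse mod_add_right_eq add.right_neutral)
  qed
  show ?thesis using aux[OF _ rot] aux[OF _ rot[symmetric]] by (metis nat_le_linear)
qed

lemma primitive_loop_aperiodic: "loop D w \<Longrightarrow> primitive D w \<Longrightarrow> aperiodic w"
  unfolding aperiodic_def using primitive_loop_nonempty rotations_of_primitive_distinct by blast

text \<open>
  The only consequence of lexicographic maximality of the shift by \<open>c\<close> that is used; stated
  without an order, since the letters carry none.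
\<close>

definition maximal_phase :: "'a list \<Rightarrow> nat \<Rightarrow> bool" where
  "maximal_phase w c \<longleftrightarrow> c < length w \<and>
     (\<forall>a l. (\<forall>k<l. w ! ((a + k) mod length w) = w ! ((c + k) mod length w)) \<longrightarrow>
        (a + l) mod length w = c \<longrightarrow> (c + l) mod length w = c)"

lemma maximal_phaseD:
  assumes "maximal_phase w c" "(a + l) mod length w = c"
    and "\<And>k. k < l \<Longrightarrow> w ! ((a + k) mod length w) = w ! ((c + k) mod length w)"
  shows "(c + l) mod length w = c"
  using assms unfolding maximal_phase_def by blast

text \<open>The lexicographically largest shift works. If a shift \<open>a\<close> runs into phase
  \<open>c\<close> after \<open>l\<close> letters on which it agrees with \<open>c\<close>, but
  \<open>c\<close> itself moves to another phase, then comparing what follows puts the shift by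
  \<open>c + l\<close> above the shift by \<open>c\<close>.\<close>

lemma ex_maximal_phase:
  fixes w :: "'a list"
  assumes "aperiodic w"
  obtains c where "maximal_phase w c"
proof -
  define m where "m = length w"
  have "m > 0" using assms by (simp add: aperiodic_def m_def)
  \<comment> \<open>An arbitrary numbering of the letters supplies the order for the lexicographic
    comparison \<open>lt\<close>.\<close>
  obtain h :: "'a \<Rightarrow> nat" where h: "inj_on h (set w)"
    using finite_imp_inj_to_nat_seg[OF finite_set] by metis
  define W where "W a k = h (w ! ((a + k) mod m))" for a k
  define lt where "lt a b \<longleftrightarrow> (\<exists>n. (\<forall>k<n. W a k = W b k) \<and> W a n < W b n)" for a b
  have W_eq: "W a k = W b l \<longleftrightarrow> w ! ((a + k) mod m) = w ! ((b + l) mod m)" for a b k l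
    using \<open>m > 0\<close> inj_on_eq_iff[OF h] by (simp add: W_def m_def)
  have W_mod: "W (a mod m) k = W a k" for a k
    by (simp add: W_def mod_add_left_eq)
  have W_add: "W (a + l) k = W a (l + k)" for a l k
    by (simp add: W_def add.assoc)
  have trans: "lt a d" if ab: "lt a b" and bd: "lt b d" for a b d
  proof -
    obtain p q where p: "\<forall>k<p. W a k = W b k" "W a p < W b p"
      and q: "\<forall>k<q. W b k = W d k" "W b q < W d q"
      using ab bd unfolding lt_def by blast
    have "(\<forall>k<min p q. W a k = W d k) \<and> W a (min p q) < W d (min p q)"
      using p q by (cases p q rule: linorder_cases) auto
    then show ?thesis unfolding lt_def by blast
  qed
  have irrefl: "\<not> lt a a" for a
    by (simp add: lt_def)
  \<comment> \<open>Aperiodicity makes different residues differ at some letter; the first such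
    letter decides.\<close>
  have total: "lt a b \<or> lt b a" if "a mod m \<noteq> b mod m" for a b
  proof -
    have "\<exists>n. W a n \<noteq> W b n"
      using that aperiodicD[OF assms, of a b] W_eq unfolding m_def by blast
    then obtain n where "W a n \<noteq> W b n" "\<forall>k<n. W a k = W b k"
      using exists_least_iff[of "\<lambda>n. W a n \<noteq> W b n"] by blast
    then show ?thesis unfolding lt_def by (metis linorder_neqE_nat)
  qed
  obtain c where c: "c < m" and max: "\<And>a. a < m \<Longrightarrow> \<not> lt c a"
    using Finite_Set.bex_max_element[of "{..<m}" lt] trans irrefl \<open>m > 0\<close>
    by (metis (mono_tags, lifting) asymp_onI empty_iff finite_lessThan lessThan_iff transp_onI)
  have max': "\<not> lt c a" for a
    using max[of "a mod m"] \<open>m > 0\<close> by (simp add: lt_def W_mod)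
  have "(c + l) mod m = c"
    if agree: "\<And>k. k < l \<Longrightarrow> w ! ((a + k) mod m) = w ! ((c + k) mod m)" and al: "(a + l) mod m = c" for a l
  proof (rule ccontr)
    assume neq: "(c + l) mod m \<noteq> c"
    have "a mod m \<noteq> c mod m"
      using neq al by (metis mod_add_left_eq)
    then have "lt a c" using total max' by blast
    then obtain n where n: "\<forall>k<n. W a k = W c k" "W a n < W c n"
      by (auto simp: lt_def)
    \<comment> \<open>The first difference lies beyond the \<open>l\<close> common letters. Cutting
      these off turns the comparison of \<open>a\<close> with \<open>c\<close> into the same
      comparison of \<open>c\<close> with \<open>c + l\<close>.\<close>
    have "n \<ge> l"
      using n(2) agree[of n] by (metis W_eq less_irrefl not_le)
    have "W c k = W a (l + k)" for k
      using W_mod[of "a + l" k] by (simp add: al W_add)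
    moreover have "W (c + l) k = W c (l + k)" for k
      by (rule W_add)
    ultimately have "\<forall>k<n - l. W c k = W (c + l) k" "W c (n - l) < W (c + l) (n - l)"
      using n \<open>n \<ge> l\<close> by auto
    then have "lt c (c + l)" unfolding lt_def by blast
    then show False using max' by blast
  qed
  then show thesis using that c unfolding maximal_phase_def m_def by blast
qed

section \<open>Decompositions of \<open>w\<close>-paths and their \<open>w\<close>-length\<close>

text \<open>The suffix \<open>u\<close> starts at phase \<open>length w - length u\<close>, and the
  phase advances by one at each letter, also across the seams between copies of \<open>w\<close>.
  Thus a decomposition is described by its start phase alone.\<close>

lemma w_decomposition_nth:
  assumes "suffix u w" "prefix v w" "k < length (u @ word_power w n @ v)" "w \<noteq> []"
  shows "(u @ word_power w n @ v) ! k = w ! ((length w - length u + k) mod length w)"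
proof -
  have power_len: "length (word_power w n) = n * length w" for n
    by (simp add: word_power_def length_concat sum_list_replicate)
  have power: "word_power w n ! i = w ! (i mod length w)" if "i < n * length w" for i n
    using that
  proof (induction n arbitrary: i)
    case (Suc n)
    show ?case
    proof (cases "i < length w")
      case False
      then have "i - length w < n * length w" using Suc.prems by auto
      then show ?thesis
        using Suc.IH[of "i - length w"] False
        by (simp add: word_power_def nth_append le_mod_geq)
    qed (simp add: word_power_def nth_append)
  qed simp
  obtain x y where x: "w = x @ u" and y: "w = v @ y"
    using assms(1,2) unfolding suffix_def prefix_def by blast
  have lx: "length w - length u = length x" using x by simp
  consider "k < length u" | "length u \<le> k" "k < length u + n * length w" | "length u + n * length w \<le> k" "k < length u + n * length w + length v"
    using assms(3) power_len by fastforce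
  then show ?thesis
  proof cases
    case 1
    then have "(length x + k) mod length w = length x + k" using x by simp
    then show ?thesis using 1 x by (simp add: nth_append lx) 
  next
    case 2
    have "(length x + k) mod length w = (length x + length u + (k - length u)) mod length w"
      using 2 by simp
    also have "\<dots> = (k - length u) mod length w" using x by (metis length_append mod_add_self1)
    finally show ?thesis using 2 power[of "k - length u" n]
      by (simp add: nth_append lx power_len less_diff_conv2)
  next
    case 3
    define r where "r = k - length u - n * length w"
    have r: "k = length u + n * length w + r" "r < length v" using 3 by (auto simp: r_def)
    have "(length x + k) mod length w = (length w + r) mod length w"
      using r(1) x by (metis (no_types, lifting) add.assoc add.commute length_append mod_mult_self2 mult.commute)
    also have "\<dots> = r" using r(2) y by simp
    finally have "(length x + k) mod length w = r" .
    moreover have "(u @ word_power w n @ v) ! k = v ! r"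
      using r by (simp add: nth_append power_len)
    moreover have "v ! r = w ! r" using r(2) y by (simp add: nth_append)
    ultimately show ?thesis by (simp add: lx)
  qed
qed

lemma circle_graph_awalk_nth:
  assumes "pre_digraph.awalk (circle_graph n) i g j" "t < length g"
  shows "g ! t = (i + t) mod n"
proof -
  have "pre_digraph.cas (circle_graph n) i g j" "i < n"
    using assms(1) by (simp_all add: pre_digraph.awalk_def circle_graph_def)
  then show ?thesis using assms(2)
  proof (induction g arbitrary: i t)
    case (Cons a g)
    then have "a = i" "pre_digraph.cas (circle_graph n) (Suc i mod n) g j" "Suc i mod n < n"
      by (auto simp: pre_digraph.cas.simps circle_graph_def)
    then show ?case using Cons by (cases t) (auto simp: mod_add_left_eq)
  qed simp
qed

text \<open>As \<open>w_length\<close> is a definite description, the decomposition has to exist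
  with a unique exponent before it can be used. Existence: cut the word at its first passage through
  phase 0. Uniqueness: aperiodicity determines the start phase, and with it the exponent.\<close>

lemma w_path_length_ge:
  assumes "aperiodic w"
    and "w_path G gE w f" "k \<le> w_length gE w f"
  shows "k * length w \<le> length f"
proof -
  define m where "m = length w"
  have "m > 0" using assms(1) by (simp add: aperiodic_def m_def)
  have power_len: "length (word_power w n) = n * m" for n
    by (simp add: word_power_def length_concat sum_list_replicate m_def)
  define P where "P n u v \<longleftrightarrow> strict_suffix u w \<and> strict_prefix v w \<and> map gE f = u @ word_power w n @ v"
    for n u v
  have P_len: "length f = length u + n * m + length v" "length u < m" "length v < m" if "P n u v" for n u v
  proof -
    have "length (map gE f) = length (u @ word_power w n @ v)" using that unfolding P_def by metis
    then show "length f = length u + n * m + length v" by (simp add: power_len)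
    show "length u < m" "length v < m" using that
      unfolding P_def m_def by (auto intro: suffix_length_less prefix_length_less)
  qed
  have P_nth: "map gE f ! t = w ! ((m - length u + t) mod m)" if "P n u v" "t < length f" for n u v t
  proof -
    have "map gE f = u @ word_power w n @ v" "suffix u w" "prefix v w"
      using that(1) unfolding P_def by (auto simp: strict_suffix_def strict_prefix_def)
    then show ?thesis
      using w_decomposition_nth[of u w v t n] that(2) \<open>m > 0\<close> unfolding m_def by (metis length_map length_greater_0_conv)
  qed
  obtain i g j where g: "pre_digraph.awalk (circle_graph m) i g j" "map gE f = map (cycle_arc w) g"
      "set g = arcs (circle_graph m)"
    using assms(2) unfolding w_path_def m_def by blast
  have "i < m" using g(1) by (simp add: pre_digraph.awalk_def circle_graph_def)
  have lg: "length g = length f" using g(2) by (metis length_map)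
  have f_nth: "map gE f ! t = w ! ((i + t) mod m)" if "t < length f" for t
    using that lg circle_graph_awalk_nth[OF g(1), of t] by (simp add: g(2) cycle_arc_def)
  \<comment> \<open>Surjectivity onto the circle yields a full period of letters, which
    \<open>aperiodicD\<close> needs below.\<close>
  have "m = card (set g)" using g(3) by (simp add: circle_graph_def)
  then have "m \<le> length f" using card_length[of g] lg by simp
  have unique: "n = n'" if "P n u v" "P n' u' v'" for n u v n' u' v'
  proof -
    have "(m - length u) mod m = (m - length u') mod m"
      unfolding m_def
    proof (rule aperiodicD[OF assms(1)], fold m_def)
      fix t assume "t < m"
      then have "t < length f" using \<open>m \<le> length f\<close> by simp
      then show "w ! ((m - length u + t) mod m) = w ! ((m - length u' + t) mod m)"
        using P_nth[OF that(1)] P_nth[OF that(2)] by metis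
    qed
    \<comment> \<open>Both lengths are below \<open>m\<close>, so the residue of
      \<open>m - length u\<close> determines \<open>length u\<close>; an empty \<open>u\<close> has
      residue 0.\<close>
    then have "length u = length u'"
      using P_len(2)[OF that(1)] P_len(2)[OF that(2)]
      by (cases "length u = 0"; cases "length u' = 0") auto
    moreover have "n = (length f - length u) div m"
      using P_len[OF that(1)] by simp
    moreover have "n' = (length f - length u') div m"
      using P_len[OF that(2)] by simp
    ultimately show ?thesis by simp
  qed
  have ex: "\<exists>n u v. P n u v"
  proof -
    \<comment> \<open>The number of letters before phase 0 is first reached. For
      \<open>i = 0\<close> it must be 0 and not \<open>m\<close>, because \<open>u\<close> has to be
      a strict suffix.\<close>
    define d where "d = (if i = 0 then 0 else m - i)"
    define n where "n = (length f - d) div m"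
    define r where "r = (length f - d) mod m"
    have d: "d < m" "d \<le> length f" "(m - d) mod m = i"
      using \<open>i < m\<close> \<open>m \<le> length f\<close> by (auto simp: d_def)
    have "r < m" using \<open>m > 0\<close> by (simp add: r_def)
    have len: "length f = d + n * m + r" using d by (simp add: n_def r_def)
    define u where "u = drop (m - d) w"
    define v where "v = take r w"
    have u: "suffix u w" "length u = d" using d by (auto simp: u_def suffix_drop m_def)
    have v: "prefix v w" "length v = r" using \<open>r < m\<close> by (auto simp: v_def take_is_prefix m_def)
    have "map gE f = u @ word_power w n @ v"
    proof (rule nth_equalityI)
      show *: "length (map gE f) = length (u @ word_power w n @ v)"
        using len u v by (simp add: power_len)
      fix t assume t: "t < length (map gE f)"
      have "(u @ word_power w n @ v) ! t = w ! ((m - d + t) mod m)"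
        using w_decomposition_nth[OF u(1) v(1), of t n] t * \<open>m > 0\<close> u(2) by (simp add: m_def)
      also have "\<dots> = w ! ((i + t) mod m)" using d(3) by (metis mod_add_left_eq)
      finally show "map gE f ! t = (u @ word_power w n @ v) ! t" using f_nth t by simp
    qed
    moreover have "u \<noteq> w" "v \<noteq> w" using u v d \<open>r < m\<close> by (auto simp: m_def)
    ultimately have "P n u v" using u v by (simp add: P_def strict_suffix_def strict_prefix_def)
    then show ?thesis by blast
  qed
  have "w_length gE w f = (THE n. \<exists>u v. P n u v)"
    by (simp add: w_length_def P_def)
  moreover have "\<exists>u v. P (THE n. \<exists>u v. P n u v) u v"
    by (rule theI') (use ex unique in blast)
  ultimately obtain u v where "P (w_length gE w f) u v" by metis
  then show ?thesis using P_len(1) assms(3) unfolding m_def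
    by (metis (no_types, lifting) le_add1 le_add2 le_trans mult_le_mono1)
qed

subsection \<open>Connected components\<close>

text \<open>Membership in \<open>U\<close> is carried along every edge of an undirected path.
  Together with the converse below, this replaces arguments about paths by arguments about sets
  closed under arcs.\<close>

lemma connected_no_cut:
  assumes "connected G" "u \<in> verts G" "u \<in> U"
    and cut: "\<And>e. e \<in> arcs G \<Longrightarrow> tail G e \<in> U \<longleftrightarrow> head G e \<in> U"
  shows "verts G \<subseteq> U"
proof
  fix v assume "v \<in> verts G"
  then have "(u, v) \<in> rtrancl_on (verts G) ((arcs_ends G)\<^sup>s)"
    using assms(1,2) by (simp add: connected_conv)
  then show "v \<in> U"
  proof (induction rule: rtrancl_on_induct)
    case (step y z)
    then show ?case using cut by (auto simp: symcl_def arcs_ends_conv)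
  qed (rule assms(3))
qed

text \<open>Apply the hypothesis to the set of vertices reachable from \<open>u\<close> by
  undirected paths.\<close>

lemma connectedI_no_cut:
  assumes "wf_digraph G" "verts G \<noteq> {}"
    and no_cut: "\<And>U u v. \<lbrakk>u \<in> verts G; u \<in> U; \<And>e. e \<in> arcs G \<Longrightarrow> tail G e \<in> U \<longleftrightarrow> head G e \<in> U;
      v \<in> verts G\<rbrakk> \<Longrightarrow> v \<in> U"
  shows "connected G"
  unfolding connected_conv
proof (intro conjI ballI)
  fix u v assume u: "u \<in> verts G" and v: "v \<in> verts G"
  let ?R = "rtrancl_on (verts G) ((arcs_ends G)\<^sup>s)"
  have step: "(u, y) \<in> ?R" if "(u, x) \<in> ?R" "(x, y) \<in> (arcs_ends G)\<^sup>s" "y \<in> verts G" for x y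
    using that by (rule rtrancl_on_into_rtrancl_on)
  have "v \<in> {x. (u, x) \<in> ?R}"
  proof (rule no_cut[OF u _ _ v])
    fix e assume e: "e \<in> arcs G"
    then have "(tail G e, head G e) \<in> (arcs_ends G)\<^sup>s" "(head G e, tail G e) \<in> (arcs_ends G)\<^sup>s"
      by (auto simp: symcl_def arcs_ends_conv image_iff)
    then show "tail G e \<in> {x. (u, x) \<in> ?R} \<longleftrightarrow> head G e \<in> {x. (u, x) \<in> ?R}"
      using step wf_digraph.wellformed[OF assms(1) e] by blast
  qed (use u in simp)
  then show "(u, v) \<in> ?R" by simp
qed (rule assms(2))

text \<open>A set closed under the arcs of the union that meets either graph contains all of that
  graph, hence \<open>x\<close>, hence all of the other.\<close>

lemma connected_union:
  assumes "wf_digraph G" "wf_digraph H" "compatible G H" "connected G" "connected H"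
    and x: "x \<in> verts G" "x \<in> verts H"
  shows "connected (union G H)"
proof (rule connectedI_no_cut)
  show "wf_digraph (union G H)" using assms(1-3) by (rule wellformed_union)
  show "verts (union G H) \<noteq> {}" using x by auto
  fix U u v assume u: "u \<in> verts (union G H)" "u \<in> U" and v: "v \<in> verts (union G H)"
    and cut: "\<And>e. e \<in> arcs (union G H) \<Longrightarrow> tail (union G H) e \<in> U \<longleftrightarrow> head (union G H) e \<in> U"
  have cutG: "e \<in> arcs G \<Longrightarrow> tail G e \<in> U \<longleftrightarrow> head G e \<in> U" for e
    using cut[of e] by simp
  have cutH: "e \<in> arcs H \<Longrightarrow> tail H e \<in> U \<longleftrightarrow> head H e \<in> U" for e
    using cut[of e] assms(3) by (simp add: compatible_def)
  have G: "y \<in> verts G \<Longrightarrow> y \<in> U \<Longrightarrow> verts G \<subseteq> U" for y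
    using connected_no_cut[OF assms(4)] cutG by blast
  have H: "y \<in> verts H \<Longrightarrow> y \<in> U \<Longrightarrow> verts H \<subseteq> U" for y
    using connected_no_cut[OF assms(5)] cutH by blast
  have "x \<in> U" using u G H x by auto
  then show "v \<in> U" using v G H x by auto
qed

section \<open>Maximality of components\<close>

text \<open>The union of \<open>C\<close> and \<open>H\<close> is connected through the common
  vertex, so maximality makes it equal to \<open>C\<close>.\<close>

lemma component_absorbs:
  assumes "C \<in> components G" "subgraph H G" "connected H" "x \<in> verts C" "x \<in> verts H"
  shows "subgraph H C"
proof -
  have C: "subgraph C G" "connected C"
    and max: "\<And>K. \<lbrakk>K \<noteq> C; subgraph C K; subgraph K G\<rbrakk> \<Longrightarrow> \<not> connected K"
    using assms(1) by (auto simp: components_def pre_digraph.max_subgraph_def)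
  have wf: "wf_digraph C" "wf_digraph H" and comp: "compatible C H"
    using C assms(2) by (auto simp: subgraph_def compatible_def)
  have "subgraph (union C H) G"
    using C assms(2) wf comp by (simp add: subgraph_union_iff)
  moreover have "connected (union C H)"
    using connected_union[OF wf comp] C assms by blast
  moreover have "subgraph C (union C H)" "subgraph H (union C H)"
    using subgraphs_of_union[OF wf comp] by auto
  ultimately show ?thesis using max by metis
qed

lemma component_unique:
  assumes "C \<in> components G" "C' \<in> components G" "x \<in> verts C" "x \<in> verts C'"
  shows "C = C'"
proof -
  have "subgraph C' C"
    using component_absorbs[OF assms(1) _ _ assms(3,4)] assms(2)
    by (auto simp: components_def pre_digraph.max_subgraph_def)
  then show ?thesis
    using assms(1,2) by (auto simp: components_def pre_digraph.max_subgraph_def)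
qed

lemma subgraph_Union_components:
  assumes "wf_digraph G" "S \<subseteq> components G"
  shows "subgraph (pre_digraph.Union G S) G"
    and "C \<in> S \<Longrightarrow> subgraph C (pre_digraph.Union G S)"
proof -
  have S: "verts C \<subseteq> verts G" "arcs C \<subseteq> arcs G" "tail C = tail G" "head C = head G" "wf_digraph C"
    if "C \<in> S" for C
    using that assms(2)
    by (auto simp: components_def pre_digraph.max_subgraph_def subgraph_def compatible_def)
  have wf: "wf_digraph (pre_digraph.Union G S)"
  proof
    fix e assume "e \<in> arcs (pre_digraph.Union G S)"
    then obtain C where C: "C \<in> S" "e \<in> arcs C" by (auto simp: pre_digraph.Union_def)
    then show "tail (pre_digraph.Union G S) e \<in> verts (pre_digraph.Union G S)"
      "head (pre_digraph.Union G S) e \<in> verts (pre_digraph.Union G S)"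
      using S[OF C(1)] wf_digraph.wellformed[of C e] by (auto simp: pre_digraph.Union_def)
  qed
  show "subgraph (pre_digraph.Union G S) G"
    by (rule subgraphI[OF _ _ _ wf assms(1)])
      (use S in \<open>auto simp: pre_digraph.Union_def compatible_def\<close>)
  show "subgraph C (pre_digraph.Union G S)" if "C \<in> S"
    by (rule subgraphI[OF _ _ _ _ wf])
      (use S[OF that] that in \<open>auto simp: pre_digraph.Union_def compatible_def\<close>)
qed

text \<open>A component of the union meets some member of \<open>S\<close> and absorbs it; being
  connected in \<open>G\<close>, it cannot be larger than that member. This transfers the condition
  that selects \<open>S\<close> to the components of the union.\<close>

lemma components_Union_subset:
  assumes "wf_digraph G" "S \<subseteq> components G"
  shows "components (pre_digraph.Union G S) \<subseteq> S"
proof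
  let ?U = "pre_digraph.Union G S"
  fix C assume C: "C \<in> components ?U"
  then have CU: "subgraph C ?U" "connected C"
    by (auto simp: components_def pre_digraph.max_subgraph_def)
  then obtain x where x: "x \<in> verts C" by (auto simp: connected_conv)
  then obtain C' where C': "C' \<in> S" "x \<in> verts C'"
    using CU(1) by (auto simp: subgraph_def pre_digraph.Union_def)
  have C'G: "C' \<in> components G" using C' assms(2) by auto
  have "subgraph C' C"
    using component_absorbs[OF C subgraph_Union_components(2)[OF assms C'(1)] _ x C'(2)] C'G
    by (auto simp: components_def pre_digraph.max_subgraph_def)
  moreover have "subgraph C G"
    using CU(1) subgraph_Union_components(1)[OF assms] by (rule subgraph_trans)
  ultimately have "C = C'"
    using C'G CU(2) by (auto simp: components_def pre_digraph.max_subgraph_def)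
  then show "C \<in> S" using C' by simp
qed

subsection \<open>Unbranched paths and segments\<close>

text \<open>Only the vertices between consecutive edges are kept off \<open>bar_V\<close>; the two
  ends are free, and edges may repeat, as on a path winding round a circle of
  \<open>G\<close>.\<close>

definition unbranched :: "('a,'b) pre_digraph \<Rightarrow> 'b list \<Rightarrow> bool" where
  "unbranched G q \<longleftrightarrow> set q \<subseteq> arcs G \<and>
     successively (\<lambda>e e'. head G e = tail G e' \<and> tail G e' \<notin> bar_V G) q"

lemma cas_imp_successively:
  "pre_digraph.cas G u p v \<Longrightarrow> successively (\<lambda>e e'. head G e = tail G e') p"
  by (induction p arbitrary: u rule: induct_list012) (auto simp: pre_digraph.cas.simps)

lemma successively_imp_cas:
  "q \<noteq> [] \<Longrightarrow> successively (\<lambda>e e'. head G e = tail G e') q \<Longrightarrow>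
    pre_digraph.cas G (tail G (hd q)) q (head G (last q))"
  by (induction q rule: induct_list012) (auto simp: pre_digraph.cas.simps)

lemma unbranched_nth:
  assumes "unbranched G q" "Suc t < length q"
  shows "head G (q ! t) = tail G (q ! Suc t)" "tail G (q ! Suc t) \<notin> bar_V G"
  using assms by (auto simp: unbranched_def successively_conv_nth)

context fin_digraph
begin

lemma out_arc_unique:
  assumes "e \<in> arcs G" "e' \<in> arcs G" "tail G e = tail G e'" "tail G e \<notin> bar_V G"
  shows "e = e'"
proof -
  have "card (out_arcs G (tail G e)) = 1"
    using assms by (simp add: bar_V_def out_degree_def)
  then obtain a where "out_arcs G (tail G e) = {a}" by (rule card_1_singletonE)
  then show ?thesis using assms by (metis in_out_arcs_conv singletonD)
qed

lemma in_arc_unique: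
  assumes "e \<in> arcs G" "e' \<in> arcs G" "head G e = head G e'" "head G e \<notin> bar_V G"
  shows "e = e'"
proof -
  have "card (in_arcs G (head G e)) = 1"
    using assms by (simp add: bar_V_def in_degree_def)
  then obtain a where "in_arcs G (head G e) = {a}" by (rule card_1_singletonE)
  then show ?thesis using assms by (metis in_in_arcs_conv singletonD)
qed

lemma ex_out_arc:
  assumes "v \<in> verts G" "v \<notin> bar_V G"
  obtains e where "e \<in> arcs G" "tail G e = v"
proof -
  have "card (out_arcs G v) = 1" using assms by (simp add: bar_V_def out_degree_def)
  then obtain a where "out_arcs G v = {a}" by (rule card_1_singletonE)
  then show ?thesis using that by (metis in_out_arcs_conv singletonI)
qed

lemma ex_in_arc:
  assumes "v \<in> verts G" "v \<notin> bar_V G"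
  obtains e where "e \<in> arcs G" "head G e = v"
proof -
  have "card (in_arcs G v) = 1" using assms by (simp add: bar_V_def in_degree_def)
  then obtain a where "in_arcs G v = {a}" by (rule card_1_singletonE)
  then show ?thesis using that by (metis in_in_arcs_conv singletonI)
qed

section \<open>Unbranched paths with an end in \<open>bar_V\<close>\<close>

text \<open>A repetition can be traced backwards, since a vertex outside \<open>bar_V\<close> has a
  single incoming edge. It would reach the first edge, whose tail is in \<open>bar_V\<close> while
  the tails of all later edges are not.\<close>

lemma unbranched_from_bar_V_distinct:
  assumes "unbranched G q" "tail G (hd q) \<in> bar_V G"
  shows "distinct q"
proof -
  have arcs: "t < length q \<Longrightarrow> q ! t \<in> arcs G" for t
    using assms(1) by (auto simp: unbranched_def)
  have "q ! s \<noteq> q ! t" if "s < t" "t < length q" for s t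
    using that
  proof (induction s arbitrary: t)
    case 0
    then have "q \<noteq> []" by auto
    then show ?case
      using 0 unbranched_nth(2)[OF assms(1), of "t - 1"] assms(2) by (auto simp: hd_conv_nth)
  next
    case (Suc s)
    then obtain t' where t: "t = Suc t'" "s < t'" by (cases t) auto
    show ?case
    proof
      assume "q ! Suc s = q ! t"
      then have "q ! s = q ! t'"
        using in_arc_unique[of "q ! s" "q ! t'"] arcs t Suc.prems
          unbranched_nth[OF assms(1), of s] unbranched_nth[OF assms(1), of t'] by auto
      then show False using Suc.IH[of t'] t Suc.prems by auto
    qed
  qed
  then show ?thesis unfolding distinct_conv_nth by (metis linorder_neqE_nat)
qed

text \<open>The mirror image: a repetition is traced forwards to the last edge. The induction
  variable \<open>k\<close> counts the edges after the later occurrence.\<close>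

lemma unbranched_to_bar_V_distinct:
  assumes "unbranched G q" "head G (last q) \<in> bar_V G"
  shows "distinct q"
proof -
  have arcs: "t < length q \<Longrightarrow> q ! t \<in> arcs G" for t
    using assms(1) by (auto simp: unbranched_def)
  have *: "q ! s \<noteq> q ! (length q - Suc k)" if "s < length q - Suc k" "k < length q" for s k
    using that
  proof (induction k arbitrary: s)
    case 0
    then have "q \<noteq> []" by auto
    then show ?case
      using 0 unbranched_nth[OF assms(1), of s] assms(2) by (auto simp: last_conv_nth)
  next
    case (Suc k)
    show ?case
    proof
      assume eq: "q ! s = q ! (length q - Suc (Suc k))"
      have "Suc (length q - Suc (Suc k)) = length q - Suc k" using Suc.prems by simp
      then have "q ! Suc s = q ! (length q - Suc k)"
        using out_arc_unique[of "q ! Suc s" "q ! (length q - Suc k)"] arcs eq Suc.prems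
          unbranched_nth[OF assms(1), of s] unbranched_nth[OF assms(1), of "length q - Suc (Suc k)"] by auto
      then show False using Suc.IH[of "Suc s"] Suc.prems by auto
    qed
  qed
  have "q ! s \<noteq> q ! t" if "s < t" "t < length q" for s t
    using that *[of s "length q - Suc t"] by (simp add: Suc_diff_Suc)
  then show ?thesis unfolding distinct_conv_nth by (metis linorder_neqE_nat)
qed

text \<open>The distinctness required of a segment comes from the start in
  \<open>bar_V\<close>.\<close>

lemma segmentI:
  assumes "q \<noteq> []" "unbranched G q" "tail G (hd q) \<in> bar_V G" "head G (last q) \<in> bar_V G"
  shows "q \<in> segments G"
proof -
  have "successively (\<lambda>e e'. head G e = tail G e') q"
    using assms(2) unfolding unbranched_def by (auto elim: successively_mono)
  then have awalk: "awalk (tail G (hd q)) q (head G (last q))"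
    using assms(1,2) subsetD[OF _ hd_in_set[OF assms(1)]]
    by (simp add: awalk_def unbranched_def successively_imp_cas)
  have "awalk_verts (tail G (hd q)) q ! i \<in> bar_V G \<longleftrightarrow> i = 0 \<or> i = length q" if "i \<le> length q" for i
  proof (cases "i < length q")
    case True
    then have "awalk_verts (tail G (hd q)) q ! i = tail G (q ! i)"
      using assms(1) by (simp add: awalk_verts_conv nth_append)
    then show ?thesis
      using True assms(1,3) unbranched_nth(2)[OF assms(2), of "i - 1"]
      by (cases i) (auto simp: hd_conv_nth)
  next
    case False
    then have "i = length q" using that by simp
    then show ?thesis using assms(1,4) by (simp add: awalk_verts_conv nth_append)
  qed
  then show ?thesis
    using assms(1) awalk unbranched_from_bar_V_distinct[OF assms(2,3)] unfolding segments_def by blast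
qed

lemma distinct_arcs_length_le: "set q \<subseteq> arcs G \<Longrightarrow> distinct q \<Longrightarrow> length q \<le> card (arcs G)"
  by (metis card_mono distinct_card finite_arcs)

text \<open>Outside \<open>bar_V\<close> there is always a next edge. The prolonged words stay
  distinct, so their length is bounded by the number of arcs and the prolongation must stop, which
  happens only in \<open>bar_V\<close>.\<close>

lemma unbranched_from_bar_V_extends:
  assumes "q \<noteq> []" "unbranched G q" "tail G (hd q) \<in> bar_V G"
  obtains r where "q @ r \<in> segments G"
  using assms
proof (induction "card (arcs G) - length q" arbitrary: q thesis rule: less_induct)
  case less
  show ?case
  proof (cases "head G (last q) \<in> bar_V G")
    case True
    then show ?thesis using less.prems(1)[of "[]"] segmentI[OF less.prems(2-4)] by simp
  next
    case False
    have "last q \<in> arcs G" using less.prems(2-4) by (auto simp: unbranched_def)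
    then obtain e where e: "e \<in> arcs G" "tail G e = head G (last q)"
      using ex_out_arc[OF head_in_verts False] by blast
    then have q': "unbranched G (q @ [e])" "tail G (hd (q @ [e])) \<in> bar_V G"
      using less.prems(2-4) False e by (auto simp: unbranched_def successively_append_iff)
    have "length (q @ [e]) \<le> card (arcs G)"
      using q'(1) unbranched_from_bar_V_distinct[OF q']
      by (intro distinct_arcs_length_le) (simp_all add: unbranched_def)
    then have "card (arcs G) - length (q @ [e]) < card (arcs G) - length q" by simp
    then show ?thesis
    proof (rule less.hyps[OF _ _ _ q'])
      fix r assume "(q @ [e]) @ r \<in> segments G"
      then show ?thesis using less.prems(1)[of "e # r"] by simp
    qed simp
  qed
qed

lemma unbranched_to_bar_V_extends:
  assumes "q \<noteq> []" "unbranched G q" "head G (last q) \<in> bar_V G"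
  obtains r where "r @ q \<in> segments G"
  using assms
proof (induction "card (arcs G) - length q" arbitrary: q thesis rule: less_induct)
  case less
  show ?case
  proof (cases "tail G (hd q) \<in> bar_V G")
    case True
    then show ?thesis using less.prems(1)[of "[]"] segmentI[OF less.prems(2,3) True less.prems(4)] by simp
  next
    case False
    have "hd q \<in> arcs G" using less.prems(2-4) by (auto simp: unbranched_def)
    then obtain e where e: "e \<in> arcs G" "head G e = tail G (hd q)"
      using ex_in_arc[OF tail_in_verts False] by blast
    then have q': "unbranched G (e # q)" "head G (last (e # q)) \<in> bar_V G"
      using less.prems(2-4) False e by (auto simp: unbranched_def successively_Cons)
    have "length (e # q) \<le> card (arcs G)"
      using q'(1) unbranched_to_bar_V_distinct[OF q']
      by (intro distinct_arcs_length_le) (simp_all add: unbranched_def)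
    then have "card (arcs G) - length (e # q) < card (arcs G) - length q" by simp
    then show ?thesis
    proof (rule less.hyps[OF _ _ _ q'])
      fix r assume "r @ e # q \<in> segments G"
      then show ?thesis using less.prems(1)[of "r @ [e]"] by simp
    qed simp
  qed
qed

lemma finite_segments: "finite (segments G)"
proof (rule finite_subset)
  show "segments G \<subseteq> {xs. set xs \<subseteq> arcs G \<and> distinct xs}"
    by (auto simp: segments_def awalk_def)
qed (rule finite_subset_distinct[OF finite_arcs])

text \<open>Segments embed into \<open>bar_E\<close> as singletons. Finiteness of
  \<open>bar_E\<close> matters because an infinite set has cardinality 0.\<close>

lemma card_segments_le: "card (segments G) \<le> card (bar_E G)"
proof (rule card_inj_on_le)
  show "inj_on (\<lambda>p. {p}) (segments G)" by simp
  show "(\<lambda>p. {p}) ` segments G \<subseteq> bar_E G" by (auto simp: bar_E_def)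
  have "finite (circles G)"
    by (rule finite_subset[OF _ finite_subset_distinct[OF finite_arcs]])
      (auto simp: circles_def awalk_def)
  then show "finite (bar_E G)"
    using finite_segments by (simp add: bar_E_def Setcompr_eq_image)
qed

end

subsection \<open>Reading the loop along a path\<close>

text \<open>The start phase \<open>i\<close> is any natural number, so that shifting it needs no
  reduction. Adjacency of consecutive edges is stated separately where it is wanted.\<close>

definition reads :: "('a \<times> nat, 'b \<times> nat) pre_digraph \<Rightarrow> nat \<Rightarrow> 'b list \<Rightarrow> nat \<Rightarrow> bool" where
  "reads C n q i \<longleftrightarrow> (\<forall>t < length q. (q ! t, (i + t) mod n) \<in> arcs C)"

lemma Suc_mod_cancel: "Suc a mod n = Suc b mod n \<Longrightarrow> a mod n = b mod n"
  by (simp add: mod_Suc split: if_splits)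

lemma readsD: "reads C n q i \<Longrightarrow> t < length q \<Longrightarrow> (q ! t, (i + t) mod n) \<in> arcs C"
  by (simp add: reads_def)

lemma reads_take: "reads C n q i \<Longrightarrow> reads C n (take k q) i"
  by (simp add: reads_def)

lemma reads_drop:
  assumes "reads C n q i"
  shows "reads C n (drop k q) (i + k)"
  unfolding reads_def
proof (intro allI impI)
  fix t assume "t < length (drop k q)"
  then show "(drop k q ! t, (i + k + t) mod n) \<in> arcs C"
    using readsD[OF assms, of "k + t"] by (simp add: add.assoc)
qed

lemma reads_mod_cong:
  assumes "reads C n q i" "i mod n = j mod n"
  shows "reads C n q j"
  unfolding reads_def
proof (intro allI impI)
  fix t assume "t < length q"
  moreover have "(i + t) mod n = (j + t) mod n"
    using assms(2) by (rule mod_add_cong) simp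
  ultimately show "(q ! t, (j + t) mod n) \<in> arcs C" using readsD[OF assms(1)] by metis
qed

lemma reads_snoc:
  assumes "reads C n q i" "(e, (i + length q) mod n) \<in> arcs C"
  shows "reads C n (q @ [e]) i"
  unfolding reads_def
proof (intro allI impI)
  fix t assume "t < length (q @ [e])"
  then consider "t < length q" | "t = length q" by force
  then show "((q @ [e]) ! t, (i + t) mod n) \<in> arcs C"
    using readsD[OF assms(1)] assms(2) by cases (simp_all add: nth_append)
qed

lemma reads_Cons:
  assumes "reads C n q (Suc i)" "(e, i mod n) \<in> arcs C"
  shows "reads C n (e # q) i"
  unfolding reads_def
proof (intro allI impI)
  fix t assume "t < length (e # q)"
  then show "((e # q) ! t, (i + t) mod n) \<in> arcs C"
    using readsD[OF assms(1)] assms(2) by (cases t) simp_all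
qed

section \<open>Subgraphs of the fibre product\<close>

locale fibre_subgraph = fin_digraph G
  for G :: "('a,'b) pre_digraph" +
  fixes D :: "('x,'y) pre_digraph" and gV :: "'a \<Rightarrow> 'x" and gE :: "'b \<Rightarrow> 'y" and w :: "'y list"
    and C :: "('a \<times> nat, 'b \<times> nat) pre_digraph"
  assumes subgraph_fibre: "subgraph C (cycle_fibre_product G D gV gE w)"
begin

abbreviation m :: nat where "m \<equiv> length w"

lemma arc_fibre:
  assumes "(e, d) \<in> arcs C"
  shows "e \<in> arcs G" "d < m" "gE e = w ! d"
    "tail C (e, d) = (tail G e, d)" "head C (e, d) = (head G e, Suc d mod m)"
proof -
  let ?F = "cycle_fibre_product G D gV gE w"
  have F: "tail C = tail ?F" "head C = head ?F" "(e, d) \<in> arcs ?F"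
    using subgraph_fibre assms unfolding subgraph_def compatible_def by auto
  show "e \<in> arcs G" "d < m" "gE e = w ! d"
    "tail C (e, d) = (tail G e, d)" "head C (e, d) = (head G e, Suc d mod m)"
    using F(3) unfolding F(1,2)
    by (simp_all add: cycle_fibre_product_def fibre_product_def circle_graph_def cycle_arc_def)
qed

lemma tail_in: "a \<in> arcs C \<Longrightarrow> tail C a \<in> verts C"
  using subgraph_fibre wf_digraph.tail_in_verts unfolding subgraph_def by metis

lemma reads_arcs: "reads C m q i \<Longrightarrow> set q \<subseteq> arcs G"
  by (metis arc_fibre(1) in_set_conv_nth readsD subsetI)

text \<open>Each edge moves the circle coordinate on by one, so a walk in \<open>C\<close> is
  recovered from its projection and its first phase.\<close>

lemma walk_reads:
  assumes "pre_digraph.awalk C a p b" "p \<noteq> []"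
  obtains i where "reads C m (map fst p) i"
    "successively (\<lambda>e e'. head G e = tail G e') (map fst p)"
proof -
  have p: "set p \<subseteq> arcs C" "pre_digraph.cas C a p b" using assms(1) by (auto simp: pre_digraph.awalk_def)
  have arc: "t < length p \<Longrightarrow> (fst (p ! t), snd (p ! t)) \<in> arcs C" for t
    using p(1) by auto
  have link: "head C (p ! t) = tail C (p ! Suc t)" if "Suc t < length p" for t
    using cas_imp_successively[OF p(2)] that by (simp add: successively_conv_nth)
  have ends: "tail C (p ! t) = (tail G (fst (p ! t)), snd (p ! t))"
    "head C (p ! t) = (head G (fst (p ! t)), Suc (snd (p ! t)) mod m)" if "t < length p" for t
    using arc_fibre(4,5)[OF arc[OF that]] by simp_all
  have phase: "snd (p ! t) = (snd (p ! 0) + t) mod m" if "t < length p" for t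
    using that
  proof (induction t)
    case 0
    then show ?case using arc_fibre(2)[OF arc] by simp
  next
    case (Suc t)
    then have "snd (p ! Suc t) = Suc (snd (p ! t)) mod m"
      using link[of t] ends[of "Suc t"] ends[of t] by simp
    then show ?case using Suc by (simp add: mod_Suc_eq)
  qed
  have "reads C m (map fst p) (snd (p ! 0))"
    unfolding reads_def using arc phase by simp
  moreover have "successively (\<lambda>e e'. head G e = tail G e') (map fst p)"
    unfolding successively_conv_nth
  proof (intro allI impI)
    fix t assume "Suc t < length (map fst p)"
    then show "head G (map fst p ! t) = tail G (map fst p ! Suc t)"
      using link[of t] ends[of "Suc t"] ends[of t] by simp
  qed
  ultimately show thesis by (rule that)
qed

text \<open>Suppose no prolongation of \<open>q\<close> read by \<open>C\<close> gets to
  \<open>bar_V\<close>. Then the vertices of \<open>C\<close> on all these prolongations form a set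
  closed under the arcs of \<open>C\<close> in both directions: an arc at such a vertex is already
  on the word or prolongs it. By connectedness this set contains \<open>x\<close>, which lies over
  \<open>bar_V\<close>.\<close>

lemma unbranched_reads_extends_to_bar_V:
  assumes "connected C" "x \<in> verts C" "fst x \<in> bar_V G"
    and q: "q \<noteq> []" "reads C m q i" "successively (\<lambda>e e'. head G e = tail G e') q"
      "\<And>e. e \<in> set q \<Longrightarrow> tail G e \<notin> bar_V G" "head G (last q) \<notin> bar_V G"
  shows "\<exists>q' i'. length q \<le> length q' \<and> reads C m q' i' \<and> unbranched G q' \<and>
    (tail G (hd q') \<in> bar_V G \<or> head G (last q') \<in> bar_V G)"
proof (rule ccontr)
  assume goal: "\<not> ?thesis"
  have no_ext: "tail G (hd q') \<notin> bar_V G \<and> head G (last q') \<notin> bar_V G"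
    if "length q \<le> length q'" "reads C m q' i'" "unbranched G q'" for q' i'
    using goal that by blast
  define free where "free r j \<longleftrightarrow> length q \<le> length r \<and> reads C m r j \<and> unbranched G r" for r j
  have free_tail: "tail G (r ! k) \<notin> bar_V G" if "free r j" "k < length r" for r j k
  proof (cases k)
    case 0
    then show ?thesis using that no_ext[of r j] unfolding free_def
      by (metis hd_conv_nth length_greater_0_conv)
  next
    case (Suc l)
    then show ?thesis using that unbranched_nth(2)[of G r l] unfolding free_def by simp
  qed
  have free_head: "head G (r ! k) \<notin> bar_V G" if "free r j" "k < length r" for r j k
  proof (cases "Suc k < length r")
    case False
    then have "r \<noteq> []" "k = length r - 1" using that(2) by auto
    then have "r \<noteq> []" "r ! k = last r" by (simp_all add: last_conv_nth)
    then show ?thesis using that(1) no_ext[of r j] unfolding free_def by simp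
  next
    case True
    then show ?thesis using that unbranched_nth[of G r k] unfolding free_def by metis
  qed
  \<comment> \<open>Both ends of each edge are collected, with their phases. The words have no
    length bound, so one that winds round a circle of \<open>G\<close> does no harm.\<close>
  define U where "U = {y. \<exists>r j k. free r j \<and> k < length r \<and>
    (y = (tail G (r ! k), (j + k) mod m) \<or> y = (head G (r ! k), Suc (j + k) mod m))}"
  have "unbranched G q"
    unfolding unbranched_def
  proof
    show "set q \<subseteq> arcs G" using q(2) by (rule reads_arcs)
    show "successively (\<lambda>e e'. head G e = tail G e' \<and> tail G e' \<notin> bar_V G) q"
      by (rule successively_mono[OF q(3)]) (use q(4) in auto)
  qed
  then have "free q i" using q(2) by (simp add: free_def)
  then have "(tail G (q ! 0), (i + 0) mod m) \<in> U"
    using q(1) unfolding U_def by blast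
  moreover have "(q ! 0, (i + 0) mod m) \<in> arcs C" using q(1,2) by (auto simp: reads_def)
  then have "(tail G (q ! 0), (i + 0) mod m) \<in> verts C" using tail_in arc_fibre(4) by metis
  moreover have "tail C a \<in> U \<longleftrightarrow> head C a \<in> U" if "a \<in> arcs C" for a
  proof -
    obtain e d where a: "a = (e, d)" by fastforce
    note ed = arc_fibre[OF that[unfolded a]]
    \<comment> \<open>Off \<open>bar_V\<close> the edge leaving a vertex is unique, so
      \<open>a\<close> projects to the edge already on the word.\<close>
    have fwd: "head C a \<in> U" if "free r j" "k < length r" "tail G e = tail G (r ! k)" "d = (j + k) mod m" for r j k
    proof -
      have "r ! k \<in> arcs G" using that by (auto simp: free_def unbranched_def)
      then have "e = r ! k" using out_arc_unique ed(1) that free_tail by metis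
      then show ?thesis using that ed(5) unfolding U_def a by (auto simp: mod_Suc_eq)
    qed
    \<comment> \<open>The same with the unique entering edge; the phases are compared at its head
      and then cancelled back to its tail.\<close>
    have bwd: "tail C a \<in> U" if "free r j" "k < length r" "head G e = head G (r ! k)"
      "Suc d mod m = Suc (j + k) mod m" for r j k
    proof -
      have "r ! k \<in> arcs G" using that by (auto simp: free_def unbranched_def)
      then have "e = r ! k" using in_arc_unique ed(1) that free_head by metis
      moreover have "d = (j + k) mod m"
        using Suc_mod_cancel[OF that(4)] ed(2) by simp
      ultimately show ?thesis using that ed(4) unfolding U_def a by auto
    qed
    show ?thesis
    proof
      assume "tail C a \<in> U"
      then obtain r j k where r: "free r j" "k < length r"
        and "(tail G e = tail G (r ! k) \<and> d = (j + k) mod m) \<or>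
          (tail G e = head G (r ! k) \<and> d = Suc (j + k) mod m)"
        using ed(4) unfolding U_def a by auto
      then consider "tail G e = tail G (r ! k)" "d = (j + k) mod m"
        | "tail G e = head G (r ! k)" "d = Suc (j + k) mod m" by blast
      then show "head C a \<in> U"
      proof cases
        case 1
        then show ?thesis using fwd r by blast
      next
        case 2
        show ?thesis
        proof (cases "Suc k < length r")
          case True
          then show ?thesis using fwd[OF r(1) True] 2 unbranched_nth(1)[of G r k] r(1)
            by (simp add: free_def)
        next
          case False
          then have "r \<noteq> []" "k = length r - 1" using r(2) by auto
          then have last: "r \<noteq> []" "Suc k = length r" "r ! k = last r"
            by (simp_all add: last_conv_nth)
          \<comment> \<open>An arc leaving the last vertex is appended, which gives a longer word of
            the same kind.\<close>
          have "unbranched G (r @ [e])"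
            using r(1) last 2 ed(1) free_head[OF r]
            by (auto simp: free_def unbranched_def successively_append_iff)
          moreover have "reads C m (r @ [e]) j"
            using r(1) that 2(2) unfolding free_def a by (intro reads_snoc) (simp_all flip: last(2))
          ultimately have "free (r @ [e]) j" using r(1) by (simp add: free_def)
          then show ?thesis
            using fwd[of "r @ [e]" j "length r"] 2(2) last(2) by (metis add_Suc_right length_append_singleton lessI nth_append_length)
        qed
      qed
    next
      assume "head C a \<in> U"
      then obtain r j k where r: "free r j" "k < length r"
        and "(head G e = tail G (r ! k) \<and> Suc d mod m = (j + k) mod m) \<or>
          (head G e = head G (r ! k) \<and> Suc d mod m = Suc (j + k) mod m)"
        using ed(5) unfolding U_def a by auto
      then consider "head G e = tail G (r ! k)" "Suc d mod m = (j + k) mod m"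
        | "head G e = head G (r ! k)" "Suc d mod m = Suc (j + k) mod m" by blast
      then show "tail C a \<in> U"
      proof cases
        case 1
        show ?thesis
        proof (cases k)
          case (Suc l)
          then show ?thesis using bwd[OF r(1), of l] r 1 unbranched_nth(1)[of G r l]
            by (simp add: free_def)
        next
          case 0
          then have hd: "r \<noteq> []" "r ! k = hd r" using r(2) by (auto simp: hd_conv_nth)
          \<comment> \<open>An arc entering the first vertex is prepended; the start phase drops by
            one to \<open>d\<close>.\<close>
          have "unbranched G (e # r)"
            using r(1) hd 1 ed(1) free_tail[OF r]
            by (auto simp: free_def unbranched_def successively_Cons)
          moreover have "reads C m r (Suc d)"
            using r(1) 1(2) 0 unfolding free_def by (auto intro: reads_mod_cong)
          then have "reads C m (e # r) d"
            using that ed(2) by (intro reads_Cons) (simp_all add: a)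
          ultimately have "free (e # r) d" using r(1) by (simp add: free_def)
          then show ?thesis
            using bwd[of "e # r" d 0] by simp
        qed
      next
        case 2
        then show ?thesis using bwd r by blast
      qed
    qed
  qed
  ultimately have "verts C \<subseteq> U" using connected_no_cut[OF assms(1)] by blast
  then obtain r j k where "free r j" "k < length r" "fst x = tail G (r ! k) \<or> fst x = head G (r ! k)"
    using assms(2) unfolding U_def by fastforce
  then show False using free_tail free_head assms(3) by metis
qed

end

subsection \<open>Claiming the ends of segments\<close>

text \<open>\<open>b\<close> selects the end: \<open>True\<close> for the start,
  \<open>False\<close> for the end of \<open>s\<close>. A complete traversal through phase
  \<open>c\<close> is booked at the start; it is the only way to claim a segment with fewer than
  \<open>n\<close> edges.\<close>

definition occupies ::
  "('a \<times> nat, 'b \<times> nat) pre_digraph \<Rightarrow> nat \<Rightarrow> nat \<Rightarrow> 'b list \<Rightarrow> bool \<Rightarrow> bool" where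
  "occupies C n c s b \<longleftrightarrow>
     (if b then (\<exists>i. reads C n s i \<and> (\<exists>t<length s. (i + t) mod n = c)) \<or>
        (\<exists>i. n \<le> length s \<and> reads C n (take n s) i)
      else (\<exists>i. n \<le> length s \<and> reads C n (drop (length s - n) s) i))"

context fibre_subgraph
begin

text \<open>The word is prolonged to a segment away from its end in \<open>bar_V\<close>. The added
  edges need not be read by \<open>C\<close>: the \<open>m\<close> edges next to that end already
  belong to \<open>q\<close>.\<close>

lemma occupies_end:
  assumes "reads C m q i" "unbranched G q" "m \<le> length q" "q \<noteq> []"
    and "tail G (hd q) \<in> bar_V G \<or> head G (last q) \<in> bar_V G"
  shows "\<exists>s\<in>segments G. \<exists>b. occupies C m c s b"
  using assms(5)
proof
  assume "tail G (hd q) \<in> bar_V G"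
  then obtain r where r: "q @ r \<in> segments G"
    using unbranched_from_bar_V_extends[OF assms(4,2)] by blast
  have "reads C m (take m (q @ r)) i" using reads_take[OF assms(1), of m] assms(3) by simp
  then have "occupies C m c (q @ r) True" using assms(3) by (auto simp: occupies_def)
  then show ?thesis using r by blast
next
  assume "head G (last q) \<in> bar_V G"
  then obtain r where r: "r @ q \<in> segments G"
    using unbranched_to_bar_V_extends[OF assms(4,2)] by blast
  have "drop (length (r @ q) - m) (r @ q) = drop (length q - m) q" using assms(3) by simp
  then have "reads C m (drop (length (r @ q) - m) (r @ q)) (i + (length q - m))"
    using reads_drop[OF assms(1)] by metis
  then have "occupies C m c (r @ q) False" using assms(3) by (auto simp: occupies_def)
  then show ?thesis using r by blast
qed

text \<open>Look at the first and the last visit to \<open>bar_V\<close>. If \<open>m\<close> edges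
  precede the first or follow the last, they run into or out of \<open>bar_V\<close> in one segment.
  Otherwise the visits enclose the middle period, which contains an edge at phase \<open>c\<close>,
  and the segment through that edge is traversed completely.\<close>

lemma component_occupies_segment:
  assumes "connected C" "x \<in> verts C" "fst x \<in> bar_V G" "c < m"
    and p: "pre_digraph.awalk C a p b" "3 * m \<le> length p"
  shows "\<exists>s\<in>segments G. \<exists>b. occupies C m c s b"
proof -
  have "m > 0" using assms(4) by (rule le_less_trans[OF le0])
  then have "p \<noteq> []" using p(2) by auto
  define q where "q = map fst p"
  obtain i where i: "reads C m q i" and walk: "successively (\<lambda>e e'. head G e = tail G e') q"
    using walk_reads[OF p(1) \<open>p \<noteq> []\<close>] unfolding q_def by blast
  have link: "head G (q ! t) = tail G (q ! Suc t)" if "Suc t < length q" for t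
    using walk that by (simp add: successively_conv_nth)
  have len: "3 * m \<le> length q" using p(2) by (simp add: q_def)
  have "q \<noteq> []" using \<open>p \<noteq> []\<close> by (simp add: q_def)
  define B where "B = {t. t < length q \<and> tail G (q ! t) \<in> bar_V G}"
  have "finite B" by (simp add: B_def)
  \<comment> \<open>Position \<open>a\<close> itself may be a visit, since the first vertex of an
    unbranched word is free.\<close>
  have unbranched: "unbranched G (take l (drop a q))"
    if "\<And>t. a < t \<Longrightarrow> t < a + l \<Longrightarrow> t \<notin> B" for a l
    unfolding unbranched_def
  proof
    show "set (take l (drop a q)) \<subseteq> arcs G"
      using reads_arcs[OF i] by (meson in_set_dropD in_set_takeD subset_iff)
    show "successively (\<lambda>e e'. head G e = tail G e' \<and> tail G e' \<notin> bar_V G) (take l (drop a q))"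
      unfolding successively_conv_nth
    proof (intro allI impI)
      fix t assume t: "Suc t < length (take l (drop a q))"
      then have lt: "Suc (a + t) < length q" by (simp add: less_diff_conv add.commute)
      then have "head G (q ! (a + t)) = tail G (q ! Suc (a + t))"
        by (rule link)
      moreover have "tail G (q ! Suc (a + t)) \<notin> bar_V G"
        using that[of "Suc (a + t)"] t lt by (simp add: B_def)
      ultimately show "head G (take l (drop a q) ! t) = tail G (take l (drop a q) ! Suc t) \<and>
          tail G (take l (drop a q) ! Suc t) \<notin> bar_V G"
        using t lt by simp
    qed
  qed
  show ?thesis
  proof (cases "B = {}")
    case True
    then have q: "unbranched G q" using unbranched[of 0 "length q"] by simp
    show ?thesis
    \<comment> \<open>\<open>B\<close> records tails only, so the final vertex of \<open>q\<close>
      is tested separately.\<close>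
    proof (cases "head G (last q) \<in> bar_V G")
      case True
      then show ?thesis using occupies_end[OF i q _ \<open>q \<noteq> []\<close>] len by simp
    next
      case False
      have "tail G e \<notin> bar_V G" if "e \<in> set q" for e
        using that \<open>B = {}\<close> by (auto simp: B_def in_set_conv_nth)
      from unbranched_reads_extends_to_bar_V[OF assms(1-3) \<open>q \<noteq> []\<close> i walk this False]
      obtain q' i' where q': "length q \<le> length q'" "reads C m q' i'" "unbranched G q'"
        "tail G (hd q') \<in> bar_V G \<or> head G (last q') \<in> bar_V G" by blast
      have "m \<le> length q'" "q' \<noteq> []" using q'(1) len \<open>q \<noteq> []\<close> by auto
      then show ?thesis using occupies_end q' by blast
    qed
  next
    case False
    define b0 where "b0 = Min B"
    define b1 where "b1 = Max B"
    have b0: "b0 \<in> B" "t \<in> B \<Longrightarrow> b0 \<le> t" for t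
      using False \<open>finite B\<close> by (auto simp: b0_def)
    have b1: "b1 \<in> B" "t \<in> B \<Longrightarrow> t \<le> b1" for t
      using False \<open>finite B\<close> by (auto simp: b1_def)
    have less: "b0 < length q" "b1 < length q" using b0(1) b1(1) by (auto simp: B_def)
    consider "m \<le> b0" | "m \<le> length q - b1" | "b0 < m" "length q - b1 < m" by linarith
    then show ?thesis
    proof cases
      case 1
      have "t \<notin> B" if "t < b0" for t using b0(2) that by (meson not_le)
      then have "unbranched G (take b0 q)" using unbranched[of 0 b0] by simp
      moreover have "0 < b0" using 1 \<open>m > 0\<close> by linarith
      then have "take b0 q \<noteq> []" "Suc (b0 - 1) = b0" using \<open>q \<noteq> []\<close> by auto
      then have "head G (q ! (b0 - 1)) = tail G (q ! b0)"
        using link[of "b0 - 1"] less(1) by simp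
      then have "head G (last (take b0 q)) \<in> bar_V G"
        using b0(1) less(1) \<open>take b0 q \<noteq> []\<close> by (simp add: last_conv_nth B_def)
      ultimately show ?thesis
        using occupies_end[OF reads_take[OF i]] 1 less(1) \<open>take b0 q \<noteq> []\<close> by simp
    next
      case 2
      have "t \<notin> B" if "b1 < t" for t using b1(2) that by (meson not_le)
      then have "unbranched G (drop b1 q)" using unbranched[of b1 "length q - b1"] by simp
      moreover have "tail G (hd (drop b1 q)) \<in> bar_V G"
        using b1(1) less(2) by (simp add: hd_drop_conv_nth B_def)
      ultimately show ?thesis
        using occupies_end[OF reads_drop[OF i]] 2 less(2) by simp
    next
      case 3
      \<comment> \<open>The position of phase \<open>c\<close> in the second period. The inner
        \<open>m\<close> avoids truncated subtraction, the outer one skips the first period.\<close>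
      define t where "t = (c + m - i mod m) mod m + m"
      have t: "m \<le> t" "t < 2 * m"
        using mod_less_divisor[OF \<open>m > 0\<close>] by (simp_all add: t_def mult_2)
      have "(i + t) mod m = (i + (c + m - i mod m) mod m) mod m"
        by (simp add: t_def flip: add.assoc)
      also have "\<dots> = (i mod m + (c + m - i mod m)) mod m"
        by (simp add: mod_simps)
      also have "i mod m + (c + m - i mod m) = c + m"
        using mod_less_divisor[OF \<open>m > 0\<close>, of i] by linarith
      finally have t_phase: "(i + t) mod m = c" using assms(4) by simp
      \<comment> \<open>The visits just before and just after edge \<open>t\<close>. A visit at
        \<open>t\<close> itself counts for \<open>l\<close>, because it is the tail of that
        edge.\<close>
      define l where "l = Max {b \<in> B. b \<le> t}"
      define r where "r = Min {b \<in> B. t < b}"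
      have "b0 \<in> {b \<in> B. b \<le> t}" using b0(1) 3 t by simp
      then have "l \<in> {b \<in> B. b \<le> t}"
        unfolding l_def using \<open>finite B\<close> by (intro Max_in) auto
      moreover have "b \<le> l" if "b \<in> B" "b \<le> t" for b
        unfolding l_def using \<open>finite B\<close> that by simp
      ultimately have l: "l \<in> B" "l \<le> t" "\<And>b. b \<in> B \<Longrightarrow> b \<le> t \<Longrightarrow> b \<le> l"
        by auto
      \<comment> \<open>Here \<open>t < 2 * m \<le> length q - m < b1\<close>.\<close>
      have "b1 \<in> {b \<in> B. t < b}" using b1(1) 3 t len less by simp
      then have "r \<in> {b \<in> B. t < b}"
        unfolding r_def using \<open>finite B\<close> by (intro Min_in) auto
      moreover have "r \<le> b" if "b \<in> B" "t < b" for b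
        unfolding r_def using \<open>finite B\<close> that by simp
      ultimately have r: "r \<in> B" "t < r" "\<And>b. b \<in> B \<Longrightarrow> t < b \<Longrightarrow> r \<le> b"
        by auto
      have rq: "r < length q" using r(1) by (simp add: B_def)
      define s where "s = take (r - l) (drop l q)"
      have ls: "length s = r - l" "l < r" using l(2) r(2) rq by (auto simp: s_def)
      then have "s \<noteq> []" by auto
      have "unbranched G s"
        unfolding s_def
      proof (rule unbranched)
        fix k assume "l < k" "k < l + (r - l)"
        then show "k \<notin> B" using l(3)[of k] r(3)[of k] by (cases "k \<le> t") auto
      qed
      moreover have "tail G (hd s) \<in> bar_V G"
        using l(1) ls(2) rq by (simp add: s_def hd_drop_conv_nth B_def)
      moreover have "Suc (r - 1) = r" using r(2) by simp
      then have "head G (q ! (r - 1)) = tail G (q ! r)"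
        using link[of "r - 1"] rq by simp
      moreover have "last s = q ! (r - 1)"
        using \<open>s \<noteq> []\<close> ls rq by (simp add: last_conv_nth) (simp add: s_def)
      ultimately have "s \<in> segments G"
        using segmentI[OF \<open>s \<noteq> []\<close>] r(1) by (simp add: B_def)
      moreover have "reads C m s (i + l)"
        unfolding s_def by (intro reads_take reads_drop i)
      moreover have "t - l < length s" "(i + l + (t - l)) mod m = c"
        using ls l(2) r(2) t_phase by auto
      ultimately have "occupies C m c s True"
        by (auto simp: occupies_def)
      then show ?thesis using \<open>s \<in> segments G\<close> by blast
    qed
  qed
qed

lemma reads_label: "reads C m q i \<Longrightarrow> t < length q \<Longrightarrow> gE (q ! t) = w ! ((i + t) mod m)"
  using readsD arc_fibre(3) by metis

lemma reads_vert:
  assumes "reads C m q i" "q \<noteq> []"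
  shows "(tail G (q ! 0), i mod m) \<in> verts C"
  using readsD[OF assms(1), of 0] assms(2) tail_in arc_fibre(4) by fastforce

end

lemma add_mod_cancel: "(a + k) mod n = (b + k) mod n \<Longrightarrow> a mod n = b mod n" for a b k n :: nat
  by (induction k) (auto dest: Suc_mod_cancel)

section \<open>Two subgraphs reading the same edges\<close>

locale fibre_subgraph_pair =
  C: fibre_subgraph G D gV gE w C + C': fibre_subgraph G D gV gE w C'
  for G :: "('a,'b) pre_digraph" and D :: "('x,'y) pre_digraph" and gV gE w C C' +
  assumes aperiodic: "aperiodic w"
begin

abbreviation n :: nat where "n \<equiv> length w"

text \<open>Both letters are the image under \<open>gE\<close> of the same edge of
  \<open>G\<close>.\<close>

lemma reads_same_label:
  assumes "reads C n q i" "reads C' n q j" "t < length q"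
  shows "w ! ((i + t) mod n) = w ! ((j + t) mod n)"
  using C.reads_label[OF assms(1,3)] C'.reads_label[OF assms(2,3)] by simp

lemma reads_long_same_phase:
  assumes "reads C n q i" "reads C' n q j" "n \<le> length q"
  shows "i mod n = j mod n"
  using reads_same_label[OF assms(1,2)] assms(3) by (intro aperiodicD[OF aperiodic]) simp

text \<open>By symmetry let \<open>t \<le> t'\<close>. The shifts by \<open>j + t\<close> and by
  \<open>c\<close> agree on \<open>t' - t\<close> letters, and the first arrives at phase
  \<open>c\<close>. Maximality makes the second arrive there too, so both readings have phase
  \<open>c\<close> at \<open>t'\<close>.\<close>

lemma reads_maximal_same_phase:
  assumes max: "maximal_phase w c"
    and reads: "reads C n q i" "reads C' n q j"
    and t: "t < length q" "(i + t) mod n = c" and t': "t' < length q" "(j + t') mod n = c"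
  shows "i mod n = j mod n"
proof -
  have aux: "i mod n = j mod n"
    if same: "\<And>k. k < length q \<Longrightarrow> w ! ((i + k) mod n) = w ! ((j + k) mod n)"
      and i: "(i + t) mod n = c" and j: "(j + t') mod n = c" and le: "t \<le> t'" "t' < length q" for i j t t'
  proof -
    have shift: "(c + k) mod n = (i + t + k) mod n" for k
      using i by (metis mod_add_left_eq)
    have "(c + (t' - t)) mod n = c"
    proof (rule maximal_phaseD[OF max])
      show "(j + t + (t' - t)) mod n = c" using j le by simp
      show "w ! ((j + t + k) mod n) = w ! ((c + k) mod n)" if "k < t' - t" for k
        using same[of "t + k"] that le shift by (simp add: add.assoc)
    qed
    then have "(i + t') mod n = c" using shift[of "t' - t"] le by simp
    then show ?thesis using add_mod_cancel[of i t' n j] j by simp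
  qed
  show ?thesis
  proof (cases "t \<le> t'")
    case True
    then show ?thesis using aux[of i j t t'] reads_same_label[OF reads] t t' by blast
  next
    case False
    then show ?thesis using aux[of j i t' t] reads_same_label[OF reads] t t' by simp
  qed
qed

lemma reads_meet:
  assumes "reads C n q i" "reads C' n q j" "q \<noteq> []" "i mod n = j mod n"
  obtains x where "x \<in> verts C" "x \<in> verts C'"
  using C.reads_vert[OF assms(1,3)] C'.reads_vert[OF assms(2,3)] assms(4) by simp

text \<open>On a segment with at least \<open>n\<close> edges, both claims read the same
  \<open>n\<close> edges and aperiodicity aligns the phases. On a shorter one both are complete
  traversals through phase \<open>c\<close>, and maximality aligns them. Aligned readings share a
  vertex.\<close>

lemma occupies_same_meet:
  assumes max: "maximal_phase w c"
    and "occupies C n c s b" "occupies C' n c s b"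
  obtains x where "x \<in> verts C" "x \<in> verts C'"
proof -
  have "\<exists>q i j. reads C n q i \<and> reads C' n q j \<and> q \<noteq> [] \<and> i mod n = j mod n"
  proof (cases "n \<le> length s")
    case True
    have "\<exists>q i. n \<le> length q \<and> reads C n q i \<and> (\<exists>j. reads C' n q j)"
    proof (cases b)
      case b: True
      \<comment> \<open>A complete traversal is cut down to its first \<open>n\<close> edges, so it
        compares with either kind of claim on the start.\<close>
      have "\<exists>i. reads C n (take n s) i" "\<exists>i. reads C' n (take n s) i"
        using assms(2,3) b by (auto simp: occupies_def intro: reads_take)
      then show ?thesis using True by (metis length_take min_absorb2 order_refl)
    next
      case False
      have "\<exists>i. reads C n (drop (length s - n) s) i" "\<exists>i. reads C' n (drop (length s - n) s) i"
        using assms(2,3) False by (auto simp: occupies_def)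
      moreover have "n \<le> length (drop (length s - n) s)" using True by simp
      ultimately show ?thesis by blast
    qed
    then show ?thesis using reads_long_same_phase aperiodic
      unfolding aperiodic_def by (metis le_zero_eq length_0_conv)
  next
    case False
    then have "b" using assms(2) by (auto simp: occupies_def split: if_splits)
    then obtain i t j t' where "reads C n s i" "t < length s" "(i + t) mod n = c"
      "reads C' n s j" "t' < length s" "(j + t') mod n = c"
      using assms(2,3) False by (auto simp: occupies_def)
    moreover from this have "i mod n = j mod n"
      using reads_maximal_same_phase[OF max] by blast
    moreover have "s \<noteq> []" using \<open>t < length s\<close> by auto
    ultimately show ?thesis by blast
  qed
  then show thesis using reads_meet that by metis
qed

end

subsection \<open>Counting components\<close>

lemma cas_ends_eq: "pre_digraph.cas G u p v \<Longrightarrow> p \<noteq> [] \<Longrightarrow> u = tail G (hd p) \<and> v = head G (last p)"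
  by (induction p arbitrary: u rule: induct_list012) (auto simp: pre_digraph.cas.simps)

text \<open>Heads of arcs are vertices because consecutive letters of \<open>w\<close> are adjacent
  in \<open>D\<close>, including the last and the first, where \<open>w\<close> closes up.\<close>

lemma wf_cycle_fibre_product:
  assumes "wf_digraph G" "graph_map G D gV gE" "loop D w"
  shows "wf_digraph (cycle_fibre_product G D gV gE w)" (is "wf_digraph ?F")
proof
  obtain x where w: "pre_digraph.cas D x w x"
    using assms(3) by (auto simp: loop_def pre_digraph.awalk_def)
  have link: "head D (w ! d) = tail D (w ! (Suc d mod length w))" if "d < length w" for d
  proof (cases "Suc d < length w")
    case True
    then show ?thesis using cas_imp_successively[OF w] by (simp add: successively_conv_nth)
  next
    case False
    then have "Suc d = length w" "w \<noteq> []" using that by auto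
    moreover from this have "d = length w - 1" by simp
    ultimately show ?thesis using cas_ends_eq[OF w] by (metis hd_conv_nth last_conv_nth mod_self)
  qed
  fix a assume "a \<in> arcs ?F"
  then obtain e d where a: "a = (e, d)" "e \<in> arcs G" "d < length w" "gE e = w ! d"
    by (auto simp: cycle_fibre_product_def fibre_product_def circle_graph_def cycle_arc_def)
  have e: "tail G e \<in> verts G" "head G e \<in> verts G"
    using wf_digraph.wellformed[OF assms(1) a(2)] by auto
  have g: "tail D (w ! d) = gV (tail G e)" "head D (w ! d) = gV (head G e)"
    using assms(2) a(2,4) unfolding graph_map_def by metis+
  have "Suc d mod length w < length w" using a(3) by (intro mod_less_divisor) auto
  then show "tail ?F a \<in> verts ?F" "head ?F a \<in> verts ?F"
    using e g link[OF a(3)] a(1,3)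
    by (simp_all add: cycle_fibre_product_def fibre_product_def circle_graph_def cycle_vert_def)
qed

theorem theorem4p22:
  fixes \<Gamma> :: "('a,'b) pre_digraph" and \<Delta> :: "('x,'y) pre_digraph"
    and \<gamma>V :: "'a \<Rightarrow> 'x" and \<gamma>E :: "'b \<Rightarrow> 'y" and w :: "'y list"
  assumes "fin_digraph \<Gamma>" and "fin_digraph \<Delta>"
    and "graph_map \<Gamma> \<Delta> \<gamma>V \<gamma>E"
    and "loop \<Delta> w" and "primitive \<Delta> w"
  shows "finite {C \<in> components (Omega_ge 4 \<Gamma> \<Delta> \<gamma>V \<gamma>E w). \<not> factors_through C (minus_bar_V \<Gamma>)} \<and>
    card {C \<in> components (Omega_ge 4 \<Gamma> \<Delta> \<gamma>V \<gamma>E w). \<not> factors_through C (minus_bar_V \<Gamma>)}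
      \<le> 2 * card (bar_E \<Gamma>)"
proof -
  interpret fin_digraph \<Gamma> by (rule assms(1))
  let ?F = "cycle_fibre_product \<Gamma> \<Delta> \<gamma>V \<gamma>E w"
  let ?\<Omega> = "Omega \<Gamma> \<Delta> \<gamma>V \<gamma>E w"
  let ?\<Omega>4 = "Omega_ge 4 \<Gamma> \<Delta> \<gamma>V \<gamma>E w"
  define X where "X = {C \<in> components ?\<Omega>4. \<not> factors_through C (minus_bar_V \<Gamma>)}"
  have aperiodic: "aperiodic w" by (rule primitive_loop_aperiodic[OF assms(4,5)])
  then obtain c where c: "maximal_phase w c" by (rule ex_maximal_phase)
  then have "c < length w" by (simp add: maximal_phase_def)
  have wf_F: "wf_digraph ?F"
    using wf_cycle_fibre_product[OF wf_digraph assms(3,4)] .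
  have \<Omega>_F: "subgraph ?\<Omega> ?F"
    unfolding Omega_def by (rule subgraph_Union_components(1)[OF wf_F]) auto
  then have wf_\<Omega>: "wf_digraph ?\<Omega>" by (simp add: subgraph_def)
  have \<Omega>4_F: "subgraph ?\<Omega>4 ?F"
    using subgraph_trans[OF _ \<Omega>_F] subgraph_Union_components(1)[OF wf_\<Omega>]
    unfolding Omega_ge_def by (metis (no_types, lifting) mem_Collect_eq subsetI)
  \<comment> \<open>Each component of the union is one of the graphs united, so it carries its own
    long path.\<close>
  have supports: "supports_w_path \<Gamma> \<gamma>E w 4 C" if "C \<in> components ?\<Omega>4" for C
    using that components_Union_subset[OF wf_\<Omega>, of "{C \<in> components ?\<Omega>. supports_w_path \<Gamma> \<gamma>E w 4 C}"]
    unfolding Omega_ge_def by auto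
  have connected: "connected C" and fibre: "fibre_subgraph \<Gamma> \<Delta> \<gamma>V \<gamma>E w C" if "C \<in> components ?\<Omega>4" for C
  proof -
    have C: "connected C" "subgraph C ?\<Omega>4"
      using that by (auto simp: components_def pre_digraph.max_subgraph_def)
    show "connected C" by (rule C(1))
    show "fibre_subgraph \<Gamma> \<Delta> \<gamma>V \<gamma>E w C"
      by unfold_locales (rule subgraph_trans[OF C(2) \<Omega>4_F])
  qed
  have "\<exists>y. fst y \<in> segments \<Gamma> \<and> occupies C (length w) c (fst y) (snd y)" if "C \<in> X" for C
  proof -
    have C: "C \<in> components ?\<Omega>4" "\<not> factors_through C (minus_bar_V \<Gamma>)"
      using that by (auto simp: X_def)
    interpret fibre_subgraph \<Gamma> \<Delta> \<gamma>V \<gamma>E w C by (rule fibre[OF C(1)])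
    have ends: "fst ` verts C \<subseteq> verts \<Gamma>" "\<And>a. a \<in> arcs C \<Longrightarrow> fst a \<in> arcs \<Gamma> \<and>
        tail \<Gamma> (fst a) \<in> fst ` verts C \<and> head \<Gamma> (fst a) \<in> fst ` verts C"
    proof -
      show "fst ` verts C \<subseteq> verts \<Gamma>"
        using subgraph_fibre by (auto simp: subgraph_def cycle_fibre_product_def fibre_product_def)
      fix a assume a: "a \<in> arcs C"
      have "tail C a \<in> verts C" "head C a \<in> verts C"
        using a subgraph_fibre by (auto simp: subgraph_def wf_digraph.wellformed)
      then show "fst a \<in> arcs \<Gamma> \<and> tail \<Gamma> (fst a) \<in> fst ` verts C \<and> head \<Gamma> (fst a) \<in> fst ` verts C"
        using arc_fibre[of "fst a" "snd a"] a by (force simp: image_iff)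
    qed
    \<comment> \<open>Since \<open>minus_bar_V\<close> is an induced subgraph, avoiding
      \<open>bar_V\<close> on vertices already forces the arcs of \<open>C\<close> into it.\<close>
    have "\<exists>x\<in>verts C. fst x \<in> bar_V \<Gamma>"
    proof (rule ccontr)
      assume "\<not> ?thesis"
      then have "fst ` verts C \<subseteq> verts \<Gamma> - bar_V \<Gamma>" using ends(1) by auto
      then have "factors_through C (minus_bar_V \<Gamma>)"
        using ends(2) unfolding factors_through_def minus_bar_V_def by fastforce
      then show False using C(2) by simp
    qed
    then obtain x where x: "x \<in> verts C" "fst x \<in> bar_V \<Gamma>" by blast
    obtain a p b where p: "pre_digraph.awalk C a p b" "w_path \<Gamma> \<gamma>E w (map fst p)"
      "4 \<le> w_length \<gamma>E w (map fst p)"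
      using supports[OF C(1)] unfolding supports_w_path_def by blast
    have "4 * length w \<le> length p"
      using w_path_length_ge[OF aperiodic p(2,3)] by simp
    then have "3 * length w \<le> length p" by simp
    then show ?thesis
      using component_occupies_segment[OF connected[OF C(1)] x \<open>c < length w\<close> p(1)] by auto
  qed
  then obtain f where f: "\<And>C. C \<in> X \<Longrightarrow> fst (f C) \<in> segments \<Gamma>"
    "\<And>C. C \<in> X \<Longrightarrow> occupies C (length w) c (fst (f C)) (snd (f C))"
    by metis
  \<comment> \<open>Two components claiming the same end share a vertex, hence coincide.\<close>
  have "inj_on f X"
  proof (rule inj_onI)
    fix C C' assume C: "C \<in> X" "C' \<in> X" "f C = f C'"
    then have comps: "C \<in> components ?\<Omega>4" "C' \<in> components ?\<Omega>4" by (auto simp: X_def)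
    interpret fibre_subgraph_pair \<Gamma> \<Delta> \<gamma>V \<gamma>E w C C'
      by (intro fibre_subgraph_pair.intro fibre_subgraph_pair_axioms.intro fibre comps aperiodic)
    obtain x where "x \<in> verts C" "x \<in> verts C'"
      using occupies_same_meet[OF c] f(2)[OF C(1)] f(2)[OF C(2)] C(3) by metis
    then show "C = C'" using component_unique[OF comps] by blast
  qed
  \<comment> \<open>The factor 2 of the bound counts the two ends of a segment, encoded by
    \<open>bool\<close>.\<close>
  moreover have "f ` X \<subseteq> segments \<Gamma> \<times> UNIV" using f(1) by (intro image_subsetI) (simp add: mem_Times_iff)
  moreover have "finite (segments \<Gamma> \<times> (UNIV :: bool set))" using finite_segments by simp
  ultimately have "finite X" "card X \<le> card (segments \<Gamma> \<times> (UNIV :: bool set))"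
    by (auto intro: inj_on_finite card_inj_on_le)
  moreover have "card (segments \<Gamma> \<times> (UNIV :: bool set)) \<le> 2 * card (bar_E \<Gamma>)"
    using card_segments_le by (simp add: card_cartesian_product)
  ultimately show ?thesis unfolding X_def by simp
qed

end
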